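(* Let $1\le p\le\infty$, let $W$ be an $L^p$ graphon, and let $(W_n)_{n\ge0}$ be a sequence of graphons with $\delta_\square(W_n,W)\to0$ as $n\to\infty$. Then $(W_n)_{n\ge0}$ is a $\|W\|_p$-upper $L^p$ regular sequence.
   Context: A graphon is a symmetric (Borel) measurable integrable function $W:[0,1]^2\to\mathbb{R}$; $\|W\|_p$ is the $L^p$ norm with respect to Lebesgue measure $\lambda$ on $[0,1]^2$ (essential supremum of $|W|$ for $p=\infty$); an $L^p$ graphon is a graphon with $\|W\|_p<\infty$. The cut norm is $\|W\|_\square=\sup_{S,T\subseteq[0,1]\text{ measurable}}\left|\int_{S\times T}W\,d\lambda\right|$, and $\delta_\square(W,W')=\inf_\sigma\|W^\sigma-W'\|_\square$ over measure-preserving bijections $\sigma:[0,1]\to[0,1]$, where $W^\sigma(x,y)=W(\sigma(x),\sigma(y))$. For a partition $\mathcal{P}=\{J_1,\dots,J_m\}$ of $[0,1]$ into measurable sets, $W_{\mathcal{P}}(x,y)=\frac{1}{\lambda(J_i)\lambda(J_j)}\int_{J_i\times J_j}W\,d\lambda$ for $(x,y)\in J_i\times J_j$. A graphon $W$ is $(C,\eta)$-upper $L^p$ regular if $\|W_{\mathcal{P}}\|_p\le C$ for every partition $\mathcal{P}$ of $[0,1]$ into measurable sets each of measure at least $\eta$. For $C\ge0$ and $1\le p\le\infty$, a sequence $(W_n)_{n\ge0}$ of graphons is $C$-upper $L^p$ regular if for every $\eta>0$ there is $n_0(\eta)$ such that $W_n$ is $(C+\eta,\eta)$-upper $L^p$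 regular for all $n\ge n_0(\eta)$. *)

theory Defs
  imports "HOL-Probability.Probability"
begin

definition unit_interval :: "real measure" where
  "unit_interval = restrict_space lborel {0..1}"

definition unit_square :: "(real \<times> real) measure" where
  "unit_square = unit_interval \<Otimes>\<^sub>M unit_interval"

(* Graphons are total functions, but only their values on the unit square are ever used.
   Measurability of W is part of integrable. *)
definition graphon :: "(real \<times> real \<Rightarrow> real) \<Rightarrow> bool" where
  "graphon W \<longleftrightarrow>
     integrable unit_square W \<and> (\<forall>x\<in>{0..1}. \<forall>y\<in>{0..1}. W (x, y) = W (y, x))"

(* The L^p norm with values in [0, \<infinity>], intended for 1 \<le> p \<le> \<infinity>.
   As powr is not available on ennreal, infinite integrals are treated separately. *)
definition Lp_norm :: "ennreal \<Rightarrow> 'a measure \<Rightarrow> ('a \<Rightarrow> real) \<Rightarrow> ennreal" where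
  "Lp_norm p M f =
     (if p = \<infinity> then esssup M (\<lambda>x. ennreal \<bar>f x\<bar>)
      else let q = enn2real p; I = (\<integral>\<^sup>+x. ennreal (\<bar>f x\<bar> powr q) \<partial>M)
           in if I = \<infinity> then \<infinity> else ennreal (enn2real I powr (1 / q)))"

definition Lp_graphon :: "ennreal \<Rightarrow> (real \<times> real \<Rightarrow> real) \<Rightarrow> bool" where
  "Lp_graphon p W \<longleftrightarrow> graphon W \<and> Lp_norm p unit_square W < \<infinity>"

(* For integrable W the supremum is over a set bounded by the L^1 norm of W. *)
definition cut_norm :: "(real \<times> real \<Rightarrow> real) \<Rightarrow> real" where
  "cut_norm W =
     (SUP (S, T) \<in> sets unit_interval \<times> sets unit_interval. \<bar>LINT z:S \<times> T|unit_square. W z\<bar>)"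

(* Measurability of the inverse is automatic for a Borel bijection of [0,1]. *)
definition mp_bijections :: "(real \<Rightarrow> real) set" where
  "mp_bijections =
     {\<sigma>. bij_betw \<sigma> {0..1} {0..1} \<and> \<sigma> \<in> unit_interval \<rightarrow>\<^sub>M unit_interval \<and>
          distr unit_interval unit_interval \<sigma> = unit_interval}"

definition relabel :: "(real \<Rightarrow> real) \<Rightarrow> (real \<times> real \<Rightarrow> real) \<Rightarrow> real \<times> real \<Rightarrow> real" where
  "relabel \<sigma> W = (\<lambda>(x, y). W (\<sigma> x, \<sigma> y))"

definition cut_dist :: "(real \<times> real \<Rightarrow> real) \<Rightarrow> (real \<times> real \<Rightarrow> real) \<Rightarrow> real" where
  "cut_dist W W' = (INF \<sigma> \<in> mp_bijections. cut_norm (\<lambda>z. relabel \<sigma> W z - W' z))"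

definition measurable_partition :: "real set set \<Rightarrow> bool" where
  "measurable_partition P \<longleftrightarrow> finite P \<and> partition_on {0..1} P \<and> P \<subseteq> sets unit_interval"

(* At a point of the unit square exactly one summand has a nonzero indicator. *)
definition step_average :: "real set set \<Rightarrow> (real \<times> real \<Rightarrow> real) \<Rightarrow> real \<times> real \<Rightarrow> real" where
  "step_average P W z =
     (\<Sum>J\<in>P. \<Sum>K\<in>P. indicator (J \<times> K) z *
        (1 / (measure unit_interval J * measure unit_interval K) *
           (LINT w:J \<times> K|unit_square. W w)))"

lemma step_average_eq:
  assumes "measurable_partition P" "J \<in> P" "K \<in> P" "x \<in> J" "y \<in> K"
  shows "step_average P W (x, y) =
    1 / (measure unit_interval J * measure unit_interval K) * (LINT w:J \<times> K|unit_square. W w)"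
proof -
  have fin: "finite P" and P: "partition_on {0..1} P"
    using assms(1) by (auto simp: measurable_partition_def)
  have uniq: "A = B" if "A \<in> P" "B \<in> P" "t \<in> A" "t \<in> B" for A B t
    using partition_onD2[OF P] that unfolding disjoint_def by blast
  define g where "g A B = 1 / (measure unit_interval A * measure unit_interval B) *
    (LINT w:A \<times> B|unit_square. W w)" for A B
  have "indicator (A \<times> B) (x, y) * g A B = (if B = K then (if A = J then g A K else 0) else 0)"
    if "A \<in> P" "B \<in> P" for A B
  proof -
    have "x \<in> A \<longleftrightarrow> A = J" "y \<in> B \<longleftrightarrow> B = K"
      using assms(2-5) uniq that by blast+
    then show ?thesis
      by (simp add: indicator_def)
  qed
  then have "step_average P W (x, y) =
      (\<Sum>A\<in>P. \<Sum>B\<in>P. if B = K then (if A = J then g A K else 0) else 0)"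
    unfolding step_average_def g_def[symmetric] by (intro sum.cong refl) blast
  also have "\<dots> = g J K"
    using fin assms(2,3) by simp
  finally show ?thesis
    unfolding g_def .
qed

definition upper_regular :: "ennreal \<Rightarrow> real \<Rightarrow> real \<Rightarrow> (real \<times> real \<Rightarrow> real) \<Rightarrow> bool" where
  "upper_regular p C \<eta> W \<longleftrightarrow>
     (\<forall>P. measurable_partition P \<and> (\<forall>J\<in>P. \<eta> \<le> measure unit_interval J) \<longrightarrow>
        Lp_norm p unit_square (step_average P W) \<le> ennreal C)"

definition upper_regular_seq ::
    "ennreal \<Rightarrow> real \<Rightarrow> (nat \<Rightarrow> real \<times> real \<Rightarrow> real) \<Rightarrow> bool" where
  "upper_regular_seq p C Ws \<longleftrightarrow>
     (\<forall>\<eta>>0. \<exists>n\<^sub>0. \<forall>n\<ge>n\<^sub>0. upper_regular p (C + \<eta>) \<eta> (Ws n))"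

end

theory Submission
  imports Defs
begin

text \<open>Let \<open>\<sigma>\<close> nearly attain the cut distance between \<open>W\<^sub>n\<close> and \<open>W\<close>. For a partition into cells of
  measure at least \<open>\<eta>\<close>, the average of \<open>W\<^sub>n\<close> over \<open>J \<times> K\<close> differs from the average of \<open>W\<close> over
  \<open>\<sigma>\<^sup>-\<^sup>1 J \<times> \<sigma>\<^sup>-\<^sup>1 K\<close>, a rectangle of the same measure, by at most the cut norm divided by \<open>\<eta>\<^sup>2\<close>.
  By Jensen's inequality the step function of the latter averages has norm at most that of \<open>W\<close>,
  and by Minkowski's inequality a perturbation of the steps by at most \<open>d\<close> costs at most \<open>d\<close>.\<close>

section \<open>Convexity of the power function\<close>

text \<open>A convex function lies above its tangents. All convexity used for finite exponents, over
  sums as well as integrals, is drawn from this inequality.\<close>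

lemma powr_above_tangent:
  fixes a x q :: real
  assumes "1 \<le> q" "0 \<le> a" "0 \<le> x"
  shows "a powr q + q * a powr (q - 1) * (x - a) \<le> x powr q"
proof (cases "a = 0 \<or> x = 0")
  \<comment> \<open>The boundary of the half-line is done by hand. At \<open>a = 0\<close> the left
    side vanishes, even for \<open>q = 1\<close>, since \<open>0 powr 0 = 0\<close>; at
    \<open>x = 0\<close> it equals \<open>(1 - q) * a powr q\<close>.\<close>
  case True
  have "a powr q \<le> q * (a powr (q - 1) * a)" if "0 < a"
  proof -
    have "a powr (q - 1) * a = a powr q"
      using that by (simp add: powr_diff)
    then show ?thesis
      using mult_right_mono[OF \<open>1 \<le> q\<close>, of "a powr q"] by simp
  qed
  with True assms show ?thesis
    by (cases "a = 0") (auto simp: algebra_simps)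
next
  case False
  then have "0 < a" "0 < x"
    using assms by auto
  have "q * a powr (q - 1) * (x - a) \<le> x powr q - a powr q"
  proof (rule convex_on_imp_above_tangent[where A = "{0<..}"])
    show "((\<lambda>x. x powr q) has_field_derivative q * a powr (q - 1)) (at a within {0<..})"
      using \<open>0 < a\<close> by (auto intro!: derivative_eq_intros)
  qed (use \<open>0 < a\<close> \<open>0 < x\<close> assms in \<open>auto intro: powr_convex simp: interior_open\<close>)
  then show ?thesis by simp
qed

text \<open>Average the tangent inequalities at the mean \<open>c\<close> with weights
  \<open>u\<close> and \<open>v\<close>: the linear terms cancel.\<close>

lemma powr_convex_combination:
  fixes u v x y q :: real
  assumes "1 \<le> q" "0 \<le> x" "0 \<le> y" "0 \<le> u" "0 \<le> v" "u + v = 1"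
  shows "(u * x + v * y) powr q \<le> u * x powr q + v * y powr q"
proof -
  define c where "c = u * x + v * y"
  have c: "0 \<le> c" using assms by (simp add: c_def)
  have "u * (c powr q + q * c powr (q - 1) * (x - c)) + v * (c powr q + q * c powr (q - 1) * (y - c))
    \<le> u * x powr q + v * y powr q"
    using assms c by (intro add_mono mult_left_mono powr_above_tangent) auto
  moreover have "u * (c powr q + q * c powr (q - 1) * (x - c)) + v * (c powr q + q * c powr (q - 1) * (y - c))
    = (u + v) * c powr q + q * c powr (q - 1) * ((u * x + v * y) - (u + v) * c)"
    by (simp add: algebra_simps)
  ultimately show ?thesis
    using assms(6) by (simp add: c_def)
qed

text \<open>This is Minkowski's inequality for a perturbation bounded by a constant. It follows from
  two-point convexity alone, applied to \<open>b\<close> normalised by \<open>C\<close>.\<close>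

lemma weighted_powr_sum_perturb:
  fixes w a b :: "'i \<Rightarrow> real"
  assumes q: "1 \<le> q" and w: "\<And>i. i \<in> I \<Longrightarrow> 0 \<le> w i" "sum w I = 1"
    and C: "0 < C" "(\<Sum>i\<in>I. w i * \<bar>b i\<bar> powr q) \<le> C powr q"
    and d: "0 \<le> d" "\<And>i. i \<in> I \<Longrightarrow> \<bar>a i - b i\<bar> \<le> d"
  shows "(\<Sum>i\<in>I. w i * \<bar>a i\<bar> powr q) \<le> (C + d) powr q"
proof -
  \<comment> \<open>With these weights \<open>\<bar>b i\<bar> + d\<close> is \<open>C + d\<close>
    times the convex combination of \<open>\<bar>b i\<bar> / C\<close> and \<open>1\<close>.\<close>
  define u v where "u = C / (C + d)" and "v = d / (C + d)"
  have uv: "0 \<le> u" "0 \<le> v" "u + v = 1"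
    using C d by (auto simp: u_def v_def add_divide_distrib[symmetric])
  have pt: "\<bar>a i\<bar> powr q \<le> (C + d) powr q * (u * (\<bar>b i\<bar> powr q / C powr q) + v)" if "i \<in> I" for i
  proof -
    have "\<bar>a i\<bar> \<le> \<bar>b i\<bar> + d"
      using d(2)[OF that] by linarith
    also have "\<bar>b i\<bar> + d = (C + d) * (u * (\<bar>b i\<bar> / C) + v * 1)"
    proof -
      have "(C + d) * u = C" "(C + d) * v = d"
        using C(1) d(1) by (auto simp: u_def v_def)
      then show ?thesis
        using C(1) by (simp add: distrib_left mult.assoc[symmetric])
    qed
    finally have "\<bar>a i\<bar> powr q \<le> ((C + d) * (u * (\<bar>b i\<bar> / C) + v * 1)) powr q"
      using q by (intro powr_mono2) auto
    also have "\<dots> = (C + d) powr q * (u * (\<bar>b i\<bar> / C) + v * 1) powr q"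
      by (rule powr_mult)
    also have "\<dots> \<le> (C + d) powr q * (u * (\<bar>b i\<bar> / C) powr q + v * 1 powr q)"
      using C(1) uv q by (intro mult_left_mono powr_convex_combination) auto
    finally show ?thesis
      using C(1) by (simp add: powr_divide)
  qed
  have "(\<Sum>i\<in>I. w i * \<bar>a i\<bar> powr q)
      \<le> (\<Sum>i\<in>I. w i * ((C + d) powr q * (u * (\<bar>b i\<bar> powr q / C powr q) + v)))"
    using w pt by (intro sum_mono mult_left_mono) auto
  also have "\<dots> = (C + d) powr q * (u * ((\<Sum>i\<in>I. w i * \<bar>b i\<bar> powr q) / C powr q) + v * sum w I)"
    by (simp add: sum_distrib_left sum_divide_distrib sum.distrib[symmetric] algebra_simps)
  \<comment> \<open>The normalised sum is at most 1 by the bound on \<open>b\<close>, and the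
    weights \<open>w\<close> sum to 1.\<close>
  also have "\<dots> \<le> (C + d) powr q * (u * 1 + v * 1)"
    using C uv w(2) by (intro mult_left_mono add_mono) (auto simp: divide_le_eq_1)
  finally show ?thesis
    using uv by simp
qed

section \<open>Averages and step functions in L^p\<close>

text \<open>Jensen's inequality on \<open>A\<close>: integrate over \<open>A\<close> the tangent
  inequality for \<open>\<bar>f x\<bar>\<close> at the absolute value \<open>b\<close> of the
  average.\<close>

lemma (in finite_measure) set_average_powr_le:
  fixes f :: "'a \<Rightarrow> real"
  assumes q: "1 \<le> q" and f: "integrable M f" and A[measurable]: "A \<in> sets M" and pos: "0 < measure M A"
  shows "ennreal (measure M A * \<bar>1 / measure M A * (LINT x:A|M. f x)\<bar> powr q)
    \<le> (\<integral>\<^sup>+x. ennreal (\<bar>f x\<bar> powr q) * indicator A x \<partial>M)"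
proof (cases "(\<integral>\<^sup>+x. ennreal (\<bar>f x\<bar> powr q) * indicator A x \<partial>M) = \<infinity>")
  \<comment> \<open>An infinite right side makes the claim trivial. A finite one makes the power
    integrable over \<open>A\<close>, so real-valued integrals can be compared.\<close>
  case False
  have [measurable]: "f \<in> borel_measurable M" using f by auto
  define b where "b = \<bar>1 / measure M A * (LINT x:A|M. f x)\<bar>"
  have b: "0 \<le> b" by (simp add: b_def)
  have eq: "(\<integral>\<^sup>+x. ennreal (\<bar>f x\<bar> powr q) * indicator A x \<partial>M)
      = (\<integral>\<^sup>+x. ennreal (indicator A x * \<bar>f x\<bar> powr q) \<partial>M)"
    by (intro nn_integral_cong) (auto split: split_indicator)
  have int: "integrable M (\<lambda>x. indicator A x * \<bar>f x\<bar> powr q)"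
    using False unfolding eq by (intro integrableI_bounded) (auto simp: top.not_eq_extremum)
  have intA: "integrable M (\<lambda>x. indicator A x :: real)"
    by (rule integrable_real_indicator[OF A]) (simp add: less_top[symmetric])
  have intf: "integrable M (\<lambda>x. indicator A x * \<bar>f x\<bar>)"
    using integrable_real_mult_indicator[OF A integrable_abs[OF f]] by (simp add: mult.commute)
  have "measure M A * b = \<bar>LINT x:A|M. f x\<bar>"
    using pos by (simp add: b_def abs_mult)
  also have "\<dots> \<le> (LINT x|M. indicator A x * \<bar>f x\<bar>)"
    unfolding set_lebesgue_integral_def
    by (rule order_trans[OF integral_abs_bound]) (simp add: abs_mult)
  finally have le: "0 \<le> (LINT x|M. indicator A x * \<bar>f x\<bar>) - measure M A * b" by simp
  \<comment> \<open>The linear term does not cancel here, because \<open>b\<close> may be smaller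
    than the average of \<open>\<bar>f x\<bar>\<close>; its sign is favourable, since the slope is
    nonnegative.\<close>
  have "measure M A * b powr q \<le> measure M A * b powr q
      + q * b powr (q - 1) * ((LINT x|M. indicator A x * \<bar>f x\<bar>) - measure M A * b)"
    using le q by simp
  also have "\<dots> = (LINT x|M. b powr q * indicator A x
      + q * b powr (q - 1) * (indicator A x * \<bar>f x\<bar> - b * indicator A x))"
    using intA intf by (simp add: mult.commute)
  also have "\<dots> \<le> (LINT x|M. indicator A x * \<bar>f x\<bar> powr q)"
    using intA intf int powr_above_tangent[OF q b abs_ge_zero]
    by (intro integral_mono) (auto split: split_indicator)
  finally have "ennreal (measure M A * b powr q) \<le> ennreal (LINT x|M. indicator A x * \<bar>f x\<bar> powr q)"
    by (rule ennreal_leI)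
  also have "\<dots> = (\<integral>\<^sup>+x. ennreal (indicator A x * \<bar>f x\<bar> powr q) \<partial>M)"
    using int by (intro nn_integral_eq_integral[symmetric]) auto
  finally show ?thesis
    unfolding eq b_def .
qed simp

lemma nn_integral_finite_partition:
  assumes "finite I" "\<And>i. i \<in> I \<Longrightarrow> A i \<in> sets M" "disjoint_family_on A I" "(\<Union>i\<in>I. A i) = space M"
    and f[measurable]: "f \<in> borel_measurable M"
  shows "(\<integral>\<^sup>+x. f x \<partial>M) = (\<Sum>i\<in>I. \<integral>\<^sup>+x. f x * indicator (A i) x \<partial>M)"
proof -
  have "(\<integral>\<^sup>+x. f x \<partial>M) = (\<integral>\<^sup>+x. f x * indicator (\<Union>i\<in>I. A i) x \<partial>M)"
    using assms(4) by (intro nn_integral_cong) auto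
  also have "\<dots> = (\<integral>\<^sup>+x. (\<Sum>i\<in>I. f x * indicator (A i) x) \<partial>M)"
    by (simp only: indicator_UN_disjoint[OF assms(1,3)] sum_distrib_left)
  also have "\<dots> = (\<Sum>i\<in>I. \<integral>\<^sup>+x. f x * indicator (A i) x \<partial>M)"
    using assms(2) by (intro nn_integral_sum) auto
  finally show ?thesis .
qed

text \<open>Raising to the power \<open>q\<close> is monotone on nonnegative reals and undoes the
  root; an infinite integral makes both sides false. Norm bounds thereby become integral bounds,
  which split over cells.\<close>

lemma Lp_norm_le_iff:
  assumes "1 \<le> p" "p \<noteq> \<infinity>" "0 \<le> C"
  shows "Lp_norm p M f \<le> ennreal C \<longleftrightarrow>
    (\<integral>\<^sup>+x. ennreal (\<bar>f x\<bar> powr enn2real p) \<partial>M) \<le> ennreal (C powr enn2real p)"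
proof -
  define q where "q = enn2real p"
  have q: "0 < q"
    using assms(1,2) unfolding q_def
    by (metis enn2real_positive_iff ennreal_zero_less_one infinity_ennreal_def order_less_le_trans top.not_eq_extremum)
  define J where "J = (\<integral>\<^sup>+x. ennreal (\<bar>f x\<bar> powr q) \<partial>M)"
  have "(if J = \<infinity> then \<infinity> else ennreal (enn2real J powr (1 / q))) \<le> ennreal C
    \<longleftrightarrow> J \<le> ennreal (C powr q)"
  proof (cases J)
    case (real r)
    have "r powr (1 / q) \<le> C \<longleftrightarrow> r \<le> C powr q"
    proof
      assume "r powr (1 / q) \<le> C"
      then have "(r powr (1 / q)) powr q \<le> C powr q"
        using q by (intro powr_mono2) auto
      then show "r \<le> C powr q"
        using real q by (simp add: powr_powr)
    next
      assume "r \<le> C powr q"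
      then have "r powr (1 / q) \<le> (C powr q) powr (1 / q)"
        using q real by (intro powr_mono2) auto
      then show "r powr (1 / q) \<le> C"
        using assms(3) q by (simp add: powr_powr)
    qed
    then show ?thesis
      using real assms(3) by simp
  next
    case top
    then show ?thesis by (simp add: top_unique)
  qed
  then show ?thesis
    using assms(2) unfolding Lp_norm_def J_def q_def by (simp add: Let_def)
qed

text \<open>The cells \<open>B i\<close> on which \<open>W\<close> is averaged need not be the cells \<open>A i\<close> carrying the step
  function, as long as the measures agree: this absorbs the relabelling in the cut distance.\<close>

lemma (in prob_space) Lp_norm_step_le:
  fixes W f :: "'a \<Rightarrow> real" and a :: "'i \<Rightarrow> real"
  assumes p: "1 \<le> p" and W: "integrable M W" and I: "finite I"
    and A: "\<And>i. i \<in> I \<Longrightarrow> A i \<in> sets M" "disjoint_family_on A I" "(\<Union>i\<in>I. A i) = space M"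
    and B: "\<And>i. i \<in> I \<Longrightarrow> B i \<in> sets M" "disjoint_family_on B I" "(\<Union>i\<in>I. B i) = space M"
    and m: "\<And>i. i \<in> I \<Longrightarrow> measure M (A i) = measure M (B i)" "\<And>i. i \<in> I \<Longrightarrow> 0 < measure M (B i)"
    and f: "f \<in> borel_measurable M" "\<And>i x. i \<in> I \<Longrightarrow> x \<in> A i \<Longrightarrow> f x = a i"
    and d: "0 \<le> d" "\<And>i. i \<in> I \<Longrightarrow> \<bar>a i - 1 / measure M (B i) * (LINT x:B i|M. W x)\<bar> \<le> d"
    and C: "0 < C" "Lp_norm p M W \<le> ennreal C"
  shows "Lp_norm p M f \<le> ennreal (C + d)"
proof -
  define b where "b i = 1 / measure M (B i) * (LINT x:B i|M. W x)" for i
  have [measurable]: "W \<in> borel_measurable M" "f \<in> borel_measurable M"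
    using W f by auto
  show ?thesis
  proof (cases "p = \<infinity>")
    case True
    have "AE x in M. ennreal \<bar>W x\<bar> \<le> ennreal C"
      using esssup_AE[of "\<lambda>x. ennreal \<bar>W x\<bar>" M] C(2) True
      by (auto simp: Lp_norm_def elim!: eventually_mono intro: order_trans)
    then have AE: "AE x in M. \<bar>W x\<bar> \<le> C"
      using C(1) by simp
    \<comment> \<open>For \<open>p = \<infinity>\<close>, averaging over a cell of positive measure
      preserves an almost everywhere bound.\<close>
    have bC: "\<bar>b i\<bar> \<le> C" if i: "i \<in> I" for i
    proof -
      have [measurable]: "B i \<in> sets M" using B i by auto
      have "\<bar>LINT x:B i|M. W x\<bar> \<le> (LINT x|M. indicator (B i) x * \<bar>W x\<bar>)"
        unfolding set_lebesgue_integral_def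
        by (rule order_trans[OF integral_abs_bound]) (simp add: abs_mult)
      also have "\<dots> \<le> (LINT x|M. C * indicator (B i) x)"
      proof (rule integral_mono_AE)
        show "integrable M (\<lambda>x. indicator (B i) x * \<bar>W x\<bar>)"
          using integrable_real_mult_indicator[OF \<open>B i \<in> sets M\<close> integrable_abs[OF W]]
          by (simp add: mult.commute)
        show "AE x in M. indicator (B i) x * \<bar>W x\<bar> \<le> C * indicator (B i) x"
          using AE by eventually_elim (auto split: split_indicator)
        show "integrable M (\<lambda>x. C * indicator (B i) x)"
          using integrable_real_indicator[OF \<open>B i \<in> sets M\<close>] by (simp add: less_top[symmetric])
      qed
      also have "\<dots> = C * measure M (B i)" by simp
      finally show ?thesis
        using m(2)[OF i] by (simp add: b_def abs_mult field_simps)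
    qed
    have "\<bar>f x\<bar> \<le> C + d" if "x \<in> space M" for x
    proof -
      obtain i where i: "i \<in> I" "x \<in> A i" using A(3) \<open>x \<in> space M\<close> by blast
      show ?thesis
        using bC[OF i(1)] d(2)[OF i(1), folded b_def] f(2)[OF i] by linarith
    qed
    then have "esssup M (\<lambda>x. ennreal \<bar>f x\<bar>) \<le> ennreal (C + d)"
      by (intro esssup_I AE_I2 ennreal_leI) auto
    then show ?thesis using True by (simp add: Lp_norm_def)
  next
    case False
    define q where "q = enn2real p"
    have q: "1 \<le> q"
      using p False enn2real_mono[of 1 p] by (simp add: q_def top.not_eq_extremum)
    \<comment> \<open>Jensen on each cell \<open>B i\<close>, summed over the partition, bounds the
      weighted power sum of the averages by the integral for \<open>W\<close>.\<close>
    have "ennreal (\<Sum>i\<in>I. measure M (B i) * \<bar>b i\<bar> powr q)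
        = (\<Sum>i\<in>I. ennreal (measure M (B i) * \<bar>b i\<bar> powr q))"
      by (intro sum_ennreal[symmetric]) auto
    also have "\<dots> \<le> (\<Sum>i\<in>I. \<integral>\<^sup>+x. ennreal (\<bar>W x\<bar> powr q) * indicator (B i) x \<partial>M)"
      unfolding b_def using B m by (intro sum_mono set_average_powr_le q W) auto
    also have "\<dots> = (\<integral>\<^sup>+x. ennreal (\<bar>W x\<bar> powr q) \<partial>M)"
      using B I by (intro nn_integral_finite_partition[symmetric]) auto
    also have "\<dots> \<le> ennreal (C powr q)"
      using C p False by (simp add: Lp_norm_le_iff q_def)
    finally have bC: "(\<Sum>i\<in>I. measure M (B i) * \<bar>b i\<bar> powr q) \<le> C powr q"
      by simp
    have "(\<Sum>i\<in>I. measure M (B i)) = measure M (\<Union>i\<in>I. B i)"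
      using B I by (intro finite_measure_finite_Union[symmetric]) auto
    then have one: "(\<Sum>i\<in>I. measure M (B i)) = 1"
      using B by (simp add: prob_space)
    have "(\<integral>\<^sup>+x. ennreal (\<bar>f x\<bar> powr q) \<partial>M)
        = (\<Sum>i\<in>I. \<integral>\<^sup>+x. ennreal (\<bar>f x\<bar> powr q) * indicator (A i) x \<partial>M)"
      using A I by (intro nn_integral_finite_partition) auto
    \<comment> \<open>Equality of measures is used here: the step function on the cells
      \<open>A i\<close> gets the same weights as the averages over the cells
      \<open>B i\<close>.\<close>
    also have "\<dots> = (\<Sum>i\<in>I. ennreal (measure M (B i) * \<bar>a i\<bar> powr q))"
    proof (intro sum.cong refl)
      fix i assume i: "i \<in> I"
      have "(\<integral>\<^sup>+x. ennreal (\<bar>f x\<bar> powr q) * indicator (A i) x \<partial>M)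
          = (\<integral>\<^sup>+x. ennreal (\<bar>a i\<bar> powr q) * indicator (A i) x \<partial>M)"
        using f(2)[OF i] by (intro nn_integral_cong) (auto split: split_indicator)
      also have "\<dots> = ennreal (\<bar>a i\<bar> powr q) * emeasure M (A i)"
        using A(1)[OF i] by (simp add: nn_integral_cmult_indicator)
      also have "\<dots> = ennreal (measure M (B i) * \<bar>a i\<bar> powr q)"
        using m(1)[OF i] by (simp add: emeasure_eq_measure ennreal_mult' mult.commute)
      finally show "(\<integral>\<^sup>+x. ennreal (\<bar>f x\<bar> powr q) * indicator (A i) x \<partial>M)
          = ennreal (measure M (B i) * \<bar>a i\<bar> powr q)" .
    qed
    also have "\<dots> = ennreal (\<Sum>i\<in>I. measure M (B i) * \<bar>a i\<bar> powr q)"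
      by (intro sum_ennreal) auto
    also have "\<dots> \<le> ennreal ((C + d) powr q)"
      using d one bC C(1) unfolding b_def[symmetric]
      by (intro ennreal_leI weighted_powr_sum_perturb[OF q, where b = b]) auto
    finally show ?thesis
      using C(1) d(1) p False by (subst Lp_norm_le_iff) (simp_all add: q_def)
  qed
qed

section \<open>Measure-preserving relabelling of the unit square\<close>

lemma space_unit_interval [simp]: "space unit_interval = {0..1}"
  by (simp add: unit_interval_def space_restrict_space)

lemma prob_space_unit_interval: "prob_space unit_interval"
  by standard (simp add: unit_interval_def emeasure_restrict_space space_restrict_space)

interpretation unit_interval: prob_space unit_interval
  by (rule prob_space_unit_interval)

interpretation unit_square: pair_prob_space unit_interval unit_interval ..

lemma space_unit_square [simp]: "space unit_square = {0..1} \<times> {0..1}"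
  by (simp add: unit_square_def space_pair_measure)

lemma prob_space_unit_square: "prob_space unit_square"
  unfolding unit_square_def by (rule unit_square.P.prob_space_axioms)

lemma sets_unit_square_Times:
  "A \<in> sets unit_interval \<Longrightarrow> B \<in> sets unit_interval \<Longrightarrow> A \<times> B \<in> sets unit_square"
  unfolding unit_square_def by simp

lemma measure_unit_square_Times:
  assumes "A \<in> sets unit_interval" "B \<in> sets unit_interval"
  shows "measure unit_square (A \<times> B) = measure unit_interval A * measure unit_interval B"
  using assms unfolding unit_square_def
  by (simp add: measure_def unit_interval.emeasure_pair_measure_Times enn2real_mult)

text \<open>The image of a product measure under a product map is the product of the image
  measures.\<close>

lemma distr_unit_square_mp:
  assumes "\<sigma> \<in> mp_bijections"
  shows "distr unit_square unit_square (\<lambda>(x, y). (\<sigma> x, \<sigma> y)) = unit_square"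
    and "(\<lambda>(x, y). (\<sigma> x, \<sigma> y)) \<in> unit_square \<rightarrow>\<^sub>M unit_square"
proof -
  have [measurable]: "\<sigma> \<in> unit_interval \<rightarrow>\<^sub>M unit_interval"
    and d: "distr unit_interval unit_interval \<sigma> = unit_interval"
    using assms by (auto simp: mp_bijections_def)
  show "distr unit_square unit_square (\<lambda>(x, y). (\<sigma> x, \<sigma> y)) = unit_square"
    using pair_measure_distr[of \<sigma> unit_interval unit_interval \<sigma> unit_interval unit_interval]
    unfolding d unit_square_def by (simp add: unit_interval.sigma_finite_measure_axioms)
  show "(\<lambda>(x, y). (\<sigma> x, \<sigma> y)) \<in> unit_square \<rightarrow>\<^sub>M unit_square"
    unfolding unit_square_def by measurable
qed

lemma integrable_relabel:
  assumes "\<sigma> \<in> mp_bijections" "integrable unit_square W"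
  shows "integrable unit_square (relabel \<sigma> W)"
  using integrable_distr[OF distr_unit_square_mp(2)[OF assms(1)], of W] assms(2)
  unfolding distr_unit_square_mp(1)[OF assms(1)] by (simp add: relabel_def case_prod_unfold)

text \<open>Change of variables along the product map: the indicator of \<open>J \<times> K\<close>
  pulls back to that of the preimage rectangle.\<close>

lemma set_integral_relabel:
  assumes \<sigma>: "\<sigma> \<in> mp_bijections" and W: "integrable unit_square W"
    and J: "J \<in> sets unit_interval" "K \<in> sets unit_interval"
  shows "(LINT z:(\<sigma> -` J \<inter> {0..1}) \<times> (\<sigma> -` K \<inter> {0..1})|unit_square. relabel \<sigma> W z)
    = (LINT z:J \<times> K|unit_square. W z)"
proof -
  have [measurable]: "W \<in> borel_measurable unit_square" "J \<times> K \<in> sets unit_square"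
    using W J sets_unit_square_Times by auto
  have "(LINT z:J \<times> K|unit_square. W z)
      = (LINT z:J \<times> K|distr unit_square unit_square (\<lambda>(x, y). (\<sigma> x, \<sigma> y)). W z)"
    by (simp add: distr_unit_square_mp(1)[OF \<sigma>])
  also have "\<dots> = (LINT z|unit_square. indicator (J \<times> K) (case z of (x, y) \<Rightarrow> (\<sigma> x, \<sigma> y)) *\<^sub>R
      W (case z of (x, y) \<Rightarrow> (\<sigma> x, \<sigma> y)))"
    unfolding set_lebesgue_integral_def
    by (rule integral_distr[OF distr_unit_square_mp(2)[OF \<sigma>]]) measurable
  also have "\<dots> = (LINT z:(\<sigma> -` J \<inter> {0..1}) \<times> (\<sigma> -` K \<inter> {0..1})|unit_square. relabel \<sigma> W z)"
    unfolding set_lebesgue_integral_def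
    by (intro Bochner_Integration.integral_cong refl)
       (auto simp: relabel_def indicator_def)
  finally show ?thesis ..
qed

section \<open>The cut norm and the cut distance\<close>

text \<open>A real supremum dominates its members once they are bounded above; here the L^1 norm of
  \<open>U\<close> is such a bound.\<close>

lemma set_integral_le_cut_norm:
  assumes "integrable unit_square U" "S \<in> sets unit_interval" "T \<in> sets unit_interval"
  shows "\<bar>LINT z:S \<times> T|unit_square. U z\<bar> \<le> cut_norm U"
proof -
  have "\<bar>LINT z:S \<times> T|unit_square. U z\<bar> \<le> (LINT z|unit_square. \<bar>U z\<bar>)"
    if "S \<in> sets unit_interval" "T \<in> sets unit_interval" for S T
  proof -
    have ST: "S \<times> T \<in> sets unit_square" using that sets_unit_square_Times by auto
    have "\<bar>LINT z:S \<times> T|unit_square. U z\<bar> \<le> (LINT z|unit_square. indicator (S \<times> T) z * \<bar>U z\<bar>)"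
      unfolding set_lebesgue_integral_def
      by (rule order_trans[OF integral_abs_bound]) (simp add: abs_mult)
    also have "\<dots> \<le> (LINT z|unit_square. \<bar>U z\<bar>)"
      using integrable_real_mult_indicator[OF ST integrable_abs[OF assms(1)]] assms(1)
      by (intro integral_mono) (auto simp: mult.commute split: split_indicator)
    finally show ?thesis .
  qed
  then have "bdd_above ((\<lambda>(S, T). \<bar>LINT z:S \<times> T|unit_square. U z\<bar>) `
      (sets unit_interval \<times> sets unit_interval))"
    by (intro bdd_aboveI2[where M = "LINT z|unit_square. \<bar>U z\<bar>"]) auto
  from cSUP_upper[OF _ this, of "(S, T)"] show ?thesis
    using assms(2,3) unfolding cut_norm_def by simp
qed

text \<open>This makes the infimum in \<open>cut_dist\<close> range over a nonempty set, so that a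
  strict upper bound on it yields a relabelling.\<close>

lemma id_mp_bijection: "(\<lambda>x. x) \<in> mp_bijections"
  by (auto simp: mp_bijections_def bij_betw_def distr_id)

section \<open>Step averages and upper regularity\<close>

lemma step_average_measurable:
  assumes "measurable_partition P"
  shows "step_average P W \<in> borel_measurable unit_square"
proof -
  have [measurable]: "J \<times> K \<in> sets unit_square" if "J \<in> P" "K \<in> P" for J K
    using that assms by (auto simp: measurable_partition_def intro: sets_unit_square_Times)
  show ?thesis
    unfolding step_average_def[abs_def] by measurable
qed

text \<open>This is the quantitative core. Every cell \<open>J \<times> K\<close> has measure at
  least \<open>\<eta>\<^sup>2\<close>, so a cut norm of at most \<open>d * \<eta>\<^sup>2\<close>
  moves each average by at most \<open>d\<close>.\<close>

lemma Lp_norm_step_average_le: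
  assumes p: "1 \<le> p" and W: "integrable unit_square W" and U: "integrable unit_square U"
    and \<sigma>: "\<sigma> \<in> mp_bijections" and eta: "0 < \<eta>" and d: "0 \<le> d"
    and cut: "cut_norm (\<lambda>z. relabel \<sigma> U z - W z) \<le> d * \<eta>\<^sup>2"
    and P: "measurable_partition P" "\<And>J. J \<in> P \<Longrightarrow> \<eta> \<le> measure unit_interval J"
    and C: "0 < C" "Lp_norm p unit_square W \<le> ennreal C"
  shows "Lp_norm p unit_square (step_average P U) \<le> ennreal (C + d)"
proof -
  interpret S: prob_space unit_square by (rule prob_space_unit_square)
  \<comment> \<open>The sets \<open>Q J\<close> partition the interval with the same measures as the
    sets \<open>J\<close>; their products are the cells on which \<open>W\<close> is
    averaged.\<close>
  define Q where "Q J = \<sigma> -` J \<inter> {0..1}" for J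
  have fin: "finite P" and part: "partition_on {0..1} P" and sets: "\<And>J. J \<in> P \<Longrightarrow> J \<in> sets unit_interval"
    using P(1) by (auto simp: measurable_partition_def)
  have \<sigma>m: "\<sigma> \<in> unit_interval \<rightarrow>\<^sub>M unit_interval"
    and \<sigma>d: "distr unit_interval unit_interval \<sigma> = unit_interval"
    and \<sigma>b: "\<And>x. x \<in> {0..1} \<Longrightarrow> \<sigma> x \<in> {0..1}"
    using \<sigma> by (auto simp: mp_bijections_def bij_betw_def)
  have Qs: "Q J \<in> sets unit_interval" if "J \<in> P" for J
    using measurable_sets[OF \<sigma>m sets[OF that]] by (simp add: Q_def)
  have Qm: "measure unit_interval (Q J) = measure unit_interval J" if "J \<in> P" for J
    using measure_distr[OF \<sigma>m sets[OF that]] by (simp add: \<sigma>d Q_def)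
  have cover: "\<exists>J\<in>P. x \<in> J" if "x \<in> {0..1}" for x
    using partition_onD1[OF part] that by auto
  have disj: "J = K" if "J \<in> P" "K \<in> P" "x \<in> J" "x \<in> K" for J K x
    using partition_onD2[OF part] that unfolding disjoint_def by blast
  show ?thesis
  proof (rule S.Lp_norm_step_le[where I = "P \<times> P" and A = "\<lambda>(J, K). J \<times> K"
        and B = "\<lambda>(J, K). Q J \<times> Q K" and W = W
        and a = "\<lambda>(J, K). 1 / (measure unit_interval J * measure unit_interval K) *
          (LINT w:J \<times> K|unit_square. U w)", OF p W _ _ _ _ _ _ _ _ _ _ _ d _ C])
    show "disjoint_family_on (\<lambda>(J, K). J \<times> K) (P \<times> P)"
      unfolding disjoint_family_on_def using disj by fast
    show "disjoint_family_on (\<lambda>(J, K). Q J \<times> Q K) (P \<times> P)"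
      unfolding disjoint_family_on_def Q_def using disj by fast
    show "(\<Union>i\<in>P \<times> P. case i of (J, K) \<Rightarrow> J \<times> K) = space unit_square"
      using partition_onD1[OF part] by auto
    show "(\<Union>i\<in>P \<times> P. case i of (J, K) \<Rightarrow> Q J \<times> Q K) = space unit_square"
    proof (intro equalityI subsetI)
      fix z :: "real \<times> real" assume "z \<in> space unit_square"
      then obtain x y where z: "z = (x, y)" "x \<in> {0..1}" "y \<in> {0..1}"
        by (cases z) auto
      obtain J K where "J \<in> P" "\<sigma> x \<in> J" "K \<in> P" "\<sigma> y \<in> K"
        using cover \<sigma>b z by meson
      then show "z \<in> (\<Union>i\<in>P \<times> P. case i of (J, K) \<Rightarrow> Q J \<times> Q K)"
        using z by (intro UN_I[of "(J, K)"]) (auto simp: Q_def)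
    qed (auto simp: Q_def)
    show "step_average P U \<in> borel_measurable unit_square"
      by (rule step_average_measurable[OF P(1)])
  next
    fix i assume i: "i \<in> P \<times> P"
    then obtain J K where JK: "i = (J, K)" "J \<in> P" "K \<in> P" by auto
    define m where "m = measure unit_interval J * measure unit_interval K"
    have m: "\<eta>\<^sup>2 \<le> m"
      unfolding m_def power2_eq_square using P(2) JK eta by (intro mult_mono) auto
    have mpos: "0 < m"
      using m eta zero_less_power[of \<eta> 2] by linarith
    have mB: "measure unit_square (Q J \<times> Q K) = m"
      using JK Qs Qm by (simp add: measure_unit_square_Times m_def)
    have int: "set_integrable unit_square (Q J \<times> Q K) (relabel \<sigma> U)"
      "set_integrable unit_square (Q J \<times> Q K) W"
      unfolding set_integrable_def
      using integrable_relabel[OF \<sigma> U] W JK Qs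
      by (auto simp del: real_scaleR_def intro!: integrable_mult_indicator sets_unit_square_Times)
    \<comment> \<open>The integral of \<open>U\<close> is moved to the preimage rectangle, where the
      difference of integrals is a single test of the cut norm.\<close>
    have "\<bar>(LINT w:J \<times> K|unit_square. U w) - (LINT w:Q J \<times> Q K|unit_square. W w)\<bar>
        = \<bar>LINT w:Q J \<times> Q K|unit_square. relabel \<sigma> U w - W w\<bar>"
      using int set_integral_relabel[OF \<sigma> U sets sets, OF JK(2,3)] by (simp add: Q_def)
    also have "\<dots> \<le> cut_norm (\<lambda>z. relabel \<sigma> U z - W z)"
      using integrable_relabel[OF \<sigma> U] W JK Qs by (intro set_integral_le_cut_norm) auto
    also have "\<dots> \<le> d * m"
      using cut mult_left_mono[OF m d] by linarith
    finally have "\<bar>1 / m * (LINT w:J \<times> K|unit_square. U w)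
        - 1 / m * (LINT w:Q J \<times> Q K|unit_square. W w)\<bar> \<le> d"
      using mpos by (simp add: diff_divide_distrib[symmetric] field_simps)
    then show "\<bar>(case i of (J, K) \<Rightarrow> 1 / (measure unit_interval J * measure unit_interval K) *
          (LINT w:J \<times> K|unit_square. U w))
        - 1 / measure unit_square (case i of (J, K) \<Rightarrow> Q J \<times> Q K) *
          (LINT x:(case i of (J, K) \<Rightarrow> Q J \<times> Q K)|unit_square. W x)\<bar> \<le> d"
      by (simp add: JK mB m_def)
    show "0 < measure unit_square (case i of (J, K) \<Rightarrow> Q J \<times> Q K)"
      using mpos by (simp add: JK mB)
    show "measure unit_square (case i of (J, K) \<Rightarrow> J \<times> K)
        = measure unit_square (case i of (J, K) \<Rightarrow> Q J \<times> Q K)"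
      using JK mB sets by (simp add: measure_unit_square_Times m_def)
    show "(case i of (J, K) \<Rightarrow> J \<times> K) \<in> sets unit_square"
      "(case i of (J, K) \<Rightarrow> Q J \<times> Q K) \<in> sets unit_square"
      using JK sets Qs by (auto intro: sets_unit_square_Times)
    fix x assume "x \<in> (case i of (J, K) \<Rightarrow> J \<times> K)"
    then show "step_average P U x = (case i of (J, K) \<Rightarrow>
        1 / (measure unit_interval J * measure unit_interval K) * (LINT w:J \<times> K|unit_square. U w))"
      using step_average_eq[OF P(1) JK(2,3)] JK(1) by auto
  qed (use fin in auto)
qed

theorem proposition2p10:
  fixes p :: ennreal
    and W :: "real \<times> real \<Rightarrow> real"
    and Ws :: "nat \<Rightarrow> real \<times> real \<Rightarrow> real"
  assumes "1 \<le> p"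
    and "Lp_graphon p W"
    and "\<And>n. graphon (Ws n)"
    and "(\<lambda>n. cut_dist (Ws n) W) \<longlonglongrightarrow> 0"
  shows "upper_regular_seq p (enn2real (Lp_norm p unit_square W)) Ws"
  unfolding upper_regular_seq_def
proof (intro allI impI)
  fix \<eta> :: real assume eta: "0 < \<eta>"
  define C where "C = enn2real (Lp_norm p unit_square W)"
  \<comment> \<open>The norm of an L^p graphon is finite, so \<open>enn2real\<close> loses
    nothing.\<close>
  have C: "0 \<le> C" "Lp_norm p unit_square W = ennreal C"
    using assms(2) by (auto simp: C_def Lp_graphon_def)
  have W: "integrable unit_square W"
    using assms(2) by (simp add: Lp_graphon_def graphon_def)
  have U: "integrable unit_square (Ws n)" for n
    using assms(3) by (simp add: graphon_def)
  \<comment> \<open>The threshold has the form \<open>d * \<eta>\<^sup>2\<close> with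
    \<open>d = \<eta> / 2\<close>; the other half of \<open>\<eta>\<close> is kept for the bound on
    \<open>W\<close>.\<close>
  have "0 < \<eta> / 2 * \<eta>\<^sup>2" using eta by simp
  from order_tendstoD(2)[OF assms(4) this]
  obtain N where N: "\<And>n. n \<ge> N \<Longrightarrow> cut_dist (Ws n) W < \<eta> / 2 * \<eta>\<^sup>2"
    unfolding eventually_sequentially by blast
  show "\<exists>n\<^sub>0. \<forall>n\<ge>n\<^sub>0. upper_regular p (enn2real (Lp_norm p unit_square W) + \<eta>) \<eta> (Ws n)"
  proof (intro exI[of _ N] allI impI)
    fix n assume "N \<le> n"
    then have "Inf ((\<lambda>\<sigma>. cut_norm (\<lambda>z. relabel \<sigma> (Ws n) z - W z)) ` mp_bijections) < \<eta> / 2 * \<eta>\<^sup>2"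
      using N by (simp add: cut_dist_def)
    then obtain \<sigma> where \<sigma>: "\<sigma> \<in> mp_bijections" "cut_norm (\<lambda>z. relabel \<sigma> (Ws n) z - W z) < \<eta> / 2 * \<eta>\<^sup>2"
      using cInf_lessD id_mp_bijection by (smt (verit) empty_iff image_iff)
    \<comment> \<open>Both \<open>N\<close> and \<open>\<sigma>\<close> are chosen before
      \<open>P\<close>, so they serve all admissible partitions at once.\<close>
    have "Lp_norm p unit_square (step_average P (Ws n)) \<le> ennreal (C + \<eta>)"
      if P: "measurable_partition P" "\<forall>J\<in>P. \<eta> \<le> measure unit_interval J" for P
    proof -
      \<comment> \<open>Enlarging \<open>C\<close> by \<open>\<eta> / 2\<close> supplies the
        strictly positive bound required for the normalisation, even when \<open>W\<close> has norm
        0.\<close>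
      have "Lp_norm p unit_square (step_average P (Ws n)) \<le> ennreal ((C + \<eta> / 2) + \<eta> / 2)"
        using P \<sigma> C eta
        by (intro Lp_norm_step_average_le[OF assms(1) W U \<sigma>(1) eta]) (auto intro: ennreal_leI)
      also have "C + \<eta> / 2 + \<eta> / 2 = C + \<eta>" by simp
      finally show ?thesis .
    qed
    then show "upper_regular p (enn2real (Lp_norm p unit_square W) + \<eta>) \<eta> (Ws n)"
      by (simp add: upper_regular_def C_def)
  qed
qed

end
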